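(* For $p\ge1$ let $n_p$ be the number of isomeric classes of rooted trees with $p$ vertices, and let $N_p=\sum_{i=1}^p n_i$. Then $$(n_1,\dots,n_{20})=(1,1,2,4,8,15,28,51,91,160,278,475,803,1342,2218,3629,5885,9455,15068,23824)$$ and $$(N_1,\dots,N_{20})=(1,2,4,8,16,31,59,110,201,361,639,1114,1917,3259,5477,9106,14991,24446,39514,63338).$$
   Context: Rooted trees are finite, unordered and unlabelled (taken up to isomorphism). The atomic stump $s_{mn}$ consists of a root with $m$ leaf children and $n$ unfilled valencies. Each rooted tree $t$ with at least two vertices factorises into atomic stumps: each non-leaf vertex of $t$ having $m$ leaf children and $n$ non-leaf children contributes one factor $s_{mn}$. For the one-vertex tree the single factor is $s_{00}$. Two rooted trees with $p$ vertices are isomeric if they have the same multiset of atomic stump factors. An isomeric class is an equivalence class under this relation (singleton classes included). The number $N_p$ is the number of order conditions for a Runge--Kutta method to have order $p$ on scalar non-autonomous problems. *)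

theory Defs
  imports "HOL-Library.Multiset"
begin

text \<open>
  A rooted tree is the multiset of its root's subtrees; using multisets rather than
  lists makes equality of values coincide with isomorphism of finite unordered
  unlabelled rooted trees.
\<close>

datatype rtree = Node (subtrees: "rtree multiset")

definition is_leaf :: "rtree \<Rightarrow> bool" where
  "is_leaf t \<longleftrightarrow> subtrees t = {#}"

primrec num_vertices :: "rtree \<Rightarrow> nat" where
  "num_vertices (Node ts) = 1 + sum_mset (image_mset num_vertices ts)"

datatype atomic_stump = Stump (leaf_children: nat) (valencies: nat)

definition root_stump :: "rtree \<Rightarrow> atomic_stump" where
  "root_stump t =
     Stump (size (filter_mset is_leaf (subtrees t)))
           (size (filter_mset (\<lambda>u. \<not> is_leaf u) (subtrees t)))"

primrec inner_stumps :: "rtree \<Rightarrow> atomic_stump multiset" where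
  "inner_stumps (Node ts) =
     (if is_leaf (Node ts) then {#}
      else add_mset (root_stump (Node ts)) (sum_mset (image_mset inner_stumps ts)))"

definition stump_factors :: "rtree \<Rightarrow> atomic_stump multiset" where
  "stump_factors t = (if is_leaf t then {#Stump 0 0#} else inner_stumps t)"

definition rtrees :: "nat \<Rightarrow> rtree set" where
  "rtrees p = {t. num_vertices t = p}"

definition isomeric :: "nat \<Rightarrow> (rtree \<times> rtree) set" where
  "isomeric p = {(t, u). t \<in> rtrees p \<and> u \<in> rtrees p \<and> stump_factors t = stump_factors u}"

lemma equiv_isomeric: "equiv (rtrees p) (isomeric p)"
  by (rule equivI) (auto simp: isomeric_def intro!: refl_onI symI transI)

definition isomeric_classes :: "nat \<Rightarrow> rtree set set" where
  "isomeric_classes p = rtrees p // isomeric p"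

definition num_isomeric :: "nat \<Rightarrow> nat" where
  "num_isomeric p = card (isomeric_classes p)"

definition num_conditions :: "nat \<Rightarrow> nat" where
  "num_conditions p = (\<Sum>i = 1..p. num_isomeric i)"

end

theory Submission imports Defs begin

text \<open>
  For \<open>p \<ge> 2\<close> an isomeric class is determined by its multiset of stumps, and the multisets that
  occur are exactly those of stumps \<open>s\<^sub>m\<^sub>n \<noteq> s\<^sub>0\<^sub>0\<close> in which \<open>m + 1\<close> sums to \<open>p\<close> (each vertex is
  either a leaf or the root of a stump) and \<open>m + n\<close> sums to \<open>p - 1\<close> (each vertex other than the
  root is a child). Such multisets are assembled into a tree by using stumps as roots of
  already built trees, those without valencies first. Their number is a coefficient of
  \<open>\<Prod>\<^sub>m\<^sub>n 1 / (1 - x\<^bsup>m + 1\<^esup> y\<^bsup>m + n\<^esup>)\<close>, which is computed one factor at a time.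
\<close>

section \<open>Stump multisets of trees\<close>

definition vertex_weight :: "atomic_stump multiset \<Rightarrow> nat" where
  "vertex_weight M = (\<Sum>s\<in>#M. Suc (leaf_children s))"

definition child_weight :: "atomic_stump multiset \<Rightarrow> nat" where
  "child_weight M = (\<Sum>s\<in>#M. leaf_children s + valencies s)"

lemma weight_simps [simp]:
  "vertex_weight {#} = 0" "child_weight {#} = 0"
  "vertex_weight (add_mset s M) = Suc (leaf_children s) + vertex_weight M"
  "child_weight (add_mset s M) = leaf_children s + valencies s + child_weight M"
  by (simp_all add: vertex_weight_def child_weight_def)

lemma weight_union [simp]:
  "vertex_weight (M + N) = vertex_weight M + vertex_weight N"
  "child_weight (M + N) = child_weight M + child_weight N"
  by (simp_all add: vertex_weight_def child_weight_def)

lemma is_leaf_Node [simp]: "is_leaf (Node ts) \<longleftrightarrow> ts = {#}"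
  by (simp add: is_leaf_def)

text \<open>Every vertex except the root is counted once, by the stump of its parent.\<close>

lemma child_weight_inner_stumps: "Suc (child_weight (inner_stumps t)) = num_vertices t"
proof (induction t)
  case (Node ts)
  \<comment> \<open>Passing to submultisets of \<open>ts\<close> keeps the induction hypothesis for
    members of \<open>ts\<close> usable; \<open>size us\<close> counts the roots of the
    subtrees.\<close>
  have "child_weight (\<Sum>u\<in>#us. inner_stumps u) + size us = (\<Sum>u\<in>#us. num_vertices u)"
    if "us \<subseteq># ts" for us
    using that
  proof (induction us)
    case (add u us)
    then have "u \<in># ts" by (meson insert_subset_eq_iff)
    from Node.IH[OF this] add show ?case
      by (auto simp: subset_mset.le_iff_add)
  qed simp
  from this[of ts] show ?case
    by (simp add: root_stump_def flip: size_union)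
qed

text \<open>A non-leaf is counted by the \<open>Suc\<close> of its own stump, a leaf by its parent's
  stump; a lone leaf has no parent.\<close>

lemma vertex_weight_inner_stumps:
  "vertex_weight (inner_stumps t) = (if is_leaf t then 0 else num_vertices t)"
proof (induction t)
  case (Node ts)
  have "size (filter_mset is_leaf us) + vertex_weight (\<Sum>u\<in>#us. inner_stumps u) =
      (\<Sum>u\<in>#us. num_vertices u)" if "us \<subseteq># ts" for us
    using that
  proof (induction us)
    case (add u us)
    then have "u \<in># ts" by (meson insert_subset_eq_iff)
    moreover have "num_vertices u = 1" if "is_leaf u"
      using that by (cases u) simp
    ultimately show ?case
      using Node.IH[of u] add by (auto simp: subset_mset.le_iff_add)
  qed simp
  from this[of ts] show ?case
    by (simp add: root_stump_def)
qed

lemma Stump_0_0_notin_inner_stumps: "Stump 0 0 \<notin># inner_stumps t"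
proof (induction t)
  case (Node ts)
  have "ts = {#}" if "root_stump (Node ts) = Stump 0 0"
    using that by (cases ts) (auto simp: root_stump_def split: if_splits)
  then have "root_stump (Node ts) \<noteq> Stump 0 0" if "ts \<noteq> {#}" using that by blast
  with Node show ?case by (auto dest!: sym[of "Stump 0 0"])
qed

text \<open>
  The invariant \<open>size M = r + \<Sum>n\<close> says that \<open>r\<close> of the \<open>size M\<close> stumps remain roots. If \<open>r = 0\<close> the
  stumps could only close up in a cycle, whence the last assumption.
\<close>
lemma exists_forest:
  assumes "Stump 0 0 \<notin># M" "size M = r + (\<Sum>s\<in>#M. valencies s)" "M \<noteq> {#} \<Longrightarrow> r \<noteq> 0"
  shows "\<exists>F. size F = r \<and> (\<forall>t\<in>#F. \<not> is_leaf t) \<and> (\<Sum>t\<in>#F. inner_stumps t) = M"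
  using assms
proof (induction "size M" arbitrary: M r)
  case 0
  then show ?case by auto
next
  case (Suc k)
  then have "M \<noteq> {#}" by auto
  \<comment> \<open>A stump with valencies is taken as long as one exists: removing it cannot lower
    the number of roots.\<close>
  then obtain s where s: "s \<in># M" "valencies s = 0 \<Longrightarrow> \<forall>s'\<in>#M. valencies s' = 0"
    by (metis multiset_nonemptyE)
  define M' where "M' = M - {#s#}"
  have M: "M = add_mset s M'" using s(1) by (simp add: M'_def)
  \<comment> \<open>With \<open>s\<close> as the root of one tree, the other stumps must supply its
    \<open>valencies s\<close> subtrees and the \<open>r - 1\<close> further trees.\<close>
  define r' where "r' = r + valencies s - 1"
  have r: "r \<noteq> 0" using Suc.prems \<open>M \<noteq> {#}\<close> by auto
  have "r' \<noteq> 0" if "M' \<noteq> {#}"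
  proof (cases "valencies s = 0")
    case True
    then have "(\<Sum>s\<in>#M. valencies s) = 0" using s(2) by simp
    then have "size M = r" using Suc.prems by simp
    with True that M show ?thesis by (cases "size M'") (auto simp: r'_def)
  qed (use r in \<open>simp add: r'_def\<close>)
  moreover have "Stump 0 0 \<notin># M'" "k = size M'" "size M' = r' + (\<Sum>s\<in>#M'. valencies s)"
    using Suc.prems Suc.hyps(2) r by (auto simp: M r'_def)
  ultimately obtain F where F: "size F = r'" "\<forall>t\<in>#F. \<not> is_leaf t"
      "(\<Sum>t\<in>#F. inner_stumps t) = M'"
    using Suc.hyps(1)[of M' r'] by blast
  obtain us where us: "F = mset us" by (metis ex_mset)
  define G H where "G = mset (take (valencies s) us)" and "H = mset (drop (valencies s) us)"
  have FGH: "F = G + H" by (simp add: us G_def H_def flip: mset_append)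
  have G: "size G = valencies s" using r F(1) by (simp add: us G_def r'_def)
  define t where "t = Node (G + replicate_mset (leaf_children s) (Node {#}))"
  have filter_G: "filter_mset is_leaf G = {#}" "filter_mset (\<lambda>u. \<not> is_leaf u) G = G"
    using F(2) by (auto simp: FGH filter_mset_eq_conv)
  have filter_replicate: "filter_mset P (replicate_mset n x) = (if P x then replicate_mset n x else {#})"
    for P n and x :: rtree
    by (induction n) auto
  have "root_stump t = s"
    by (simp add: t_def root_stump_def filter_G filter_replicate G)
  moreover have t: "\<not> is_leaf t"
    using G Suc.prems(1) by (cases s) (auto simp: t_def M)
  ultimately have "inner_stumps t = add_mset s (\<Sum>u\<in>#G. inner_stumps u)"
    by (simp add: t_def)
  with F t G r show ?case
    by (intro exI[of _ "add_mset t H"]) (auto simp: FGH M r'_def)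
qed

definition stump_multisets :: "atomic_stump set \<Rightarrow> nat \<Rightarrow> nat \<Rightarrow> atomic_stump multiset set" where
  "stump_multisets X p w = {M. set_mset M \<subseteq> X \<and> vertex_weight M = p \<and> child_weight M = w}"

lemma stump_factors_image:
  "stump_factors ` rtrees (Suc (Suc q)) = stump_multisets (- {Stump 0 0}) (Suc (Suc q)) (Suc q)"
proof (intro equalityI subsetI)
  fix M assume "M \<in> stump_factors ` rtrees (Suc (Suc q))"
  then obtain t where t: "num_vertices t = Suc (Suc q)" "M = stump_factors t"
    by (auto simp: rtrees_def)
  then have "\<not> is_leaf t" by (cases t) auto
  with t show "M \<in> stump_multisets (- {Stump 0 0}) (Suc (Suc q)) (Suc q)"
    using child_weight_inner_stumps[of t] vertex_weight_inner_stumps[of t]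
      Stump_0_0_notin_inner_stumps[of t]
    by (auto simp: stump_multisets_def stump_factors_def)
next
  fix M assume "M \<in> stump_multisets (- {Stump 0 0}) (Suc (Suc q)) (Suc q)"
  then have M: "Stump 0 0 \<notin># M" "vertex_weight M = Suc (Suc q)" "child_weight M = Suc q"
    by (auto simp: stump_multisets_def)
  \<comment> \<open>Stumpwise this is \<open>(m + n) + 1 = (m + 1) + n\<close>. As the two weights
    of \<open>M\<close> differ by 1, exactly one root remains.\<close>
  have "child_weight N + size N = vertex_weight N + (\<Sum>s\<in>#N. valencies s)" for N
    by (induction N) auto
  from this[of M] have "size M = 1 + (\<Sum>s\<in>#M. valencies s)" using M by simp
  from exists_forest[OF M(1) this] obtain F where F: "size F = 1" "\<forall>t\<in>#F. \<not> is_leaf t"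
      "(\<Sum>t\<in>#F. inner_stumps t) = M" by auto
  then obtain t where "F = {#t#}" by (metis One_nat_def size_1_singleton_mset)
  with F have t: "\<not> is_leaf t" "inner_stumps t = M" by auto
  then have "t \<in> rtrees (Suc (Suc q))"
    using vertex_weight_inner_stumps[of t] M by (simp add: rtrees_def)
  with t show "M \<in> stump_factors ` rtrees (Suc (Suc q))"
    by (force simp: stump_factors_def)
qed

text \<open>The isomeric classes are the nonempty fibres of \<open>stump_factors\<close>.\<close>

lemma num_isomeric_eq_card_image: "num_isomeric p = card (stump_factors ` rtrees p)"
proof -
  have "bij_betw (\<lambda>M. {t \<in> rtrees p. stump_factors t = M})
      (stump_factors ` rtrees p) (isomeric_classes p)"
    unfolding bij_betw_def
  proof
    show "inj_on (\<lambda>M. {t \<in> rtrees p. stump_factors t = M}) (stump_factors ` rtrees p)"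
      by (auto simp: inj_on_def)
    show "(\<lambda>M. {t \<in> rtrees p. stump_factors t = M}) ` stump_factors ` rtrees p = isomeric_classes p"
      by (auto simp: isomeric_classes_def quotient_def isomeric_def image_image
          eq_commute[of "stump_factors _" "stump_factors _"])
  qed
  then show ?thesis by (simp add: num_isomeric_def bij_betw_same_card)
qed

lemma num_isomeric_1: "num_isomeric 1 = 1"
proof -
  have "num_vertices t = 1 \<longleftrightarrow> t = Node {#}" for t
  proof
    assume *: "num_vertices t = 1"
    obtain ts where t: "t = Node ts" by (cases t)
    show "t = Node {#}"
    proof (cases ts)
      case (add u us)
      with * t show ?thesis by (cases u) simp
    qed (simp add: t)
  qed simp
  then have "rtrees 1 = {Node {#}}" by (auto simp: rtrees_def)
  then show ?thesis by (simp add: num_isomeric_eq_card_image)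
qed

section \<open>Counting stump multisets\<close>

text \<open>Each stump has vertex weight at least 1, so at most \<open>p\<close> stumps
  occur.\<close>

lemma finite_stump_multisets:
  assumes "finite X"
  shows "finite (stump_multisets X p w)"
proof -
  have size: "size M \<le> vertex_weight M" for M by (induction M) auto
  have "stump_multisets X p w \<subseteq> mset ` {xs. set xs \<subseteq> X \<and> length xs \<le> p}"
  proof
    fix M assume "M \<in> stump_multisets X p w"
    moreover obtain xs where "M = mset xs" by (metis ex_mset)
    ultimately show "M \<in> mset ` {xs. set xs \<subseteq> X \<and> length xs \<le> p}"
      using size[of M] by (auto simp: stump_multisets_def)
  qed
  then show ?thesis
    by (rule finite_subset) (intro finite_imageI finite_lists_length_le assms)
qed

text \<open>Split by whether the new stump occurs; if it does, removing one copy is a bijection. The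
  guard excludes truncated subtraction.\<close>

lemma card_stump_multisets_insert:
  assumes "finite X" "Stump m n \<notin> X"
  shows "card (stump_multisets (insert (Stump m n) X) p w) =
    card (stump_multisets X p w) +
    (if m < p \<and> m + n \<le> w
     then card (stump_multisets (insert (Stump m n) X) (p - Suc m) (w - (m + n))) else 0)"
proof -
  let ?X = "insert (Stump m n) X"
  let ?B = "{M \<in> stump_multisets ?X p w. Stump m n \<in># M}"
  have "stump_multisets ?X p w = stump_multisets X p w \<union> ?B"
    by (auto simp: stump_multisets_def)
  moreover have "stump_multisets X p w \<inter> ?B = {}"
    using assms(2) by (auto simp: stump_multisets_def)
  moreover have fin: "finite (stump_multisets X p w)" "finite (stump_multisets ?X p w)"
    by (simp_all add: finite_stump_multisets assms)
  ultimately have "card (stump_multisets ?X p w) = card (stump_multisets X p w) + card ?B"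
    by (metis (no_types, lifting) card_Un_disjoint finite_Un)
  moreover have "?B = (if m < p \<and> m + n \<le> w
      then add_mset (Stump m n) ` stump_multisets ?X (p - Suc m) (w - (m + n)) else {})"
    (is "_ = ?C")
  proof (intro equalityI subsetI)
    fix M assume "M \<in> ?B"
    moreover from this obtain M' where "M = add_mset (Stump m n) M'"
      by (auto dest: multi_member_split)
    ultimately show "M \<in> ?C" by (auto simp: stump_multisets_def)
  qed (auto simp: stump_multisets_def split: if_splits)
  ultimately show ?thesis
    by (simp add: card_image inj_on_def)
qed

section \<open>Tables of generating function coefficients\<close>

definition count_table :: "nat \<Rightarrow> nat \<Rightarrow> atomic_stump set \<Rightarrow> int list list" where
  "count_table P W X =
     map (\<lambda>p. map (\<lambda>w. int (card (stump_multisets X p w))) [0..<W]) [0..<P]"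

text \<open>
  Multiplication of a table of coefficients of \<open>x\<^sup>p y\<^sup>w\<close> (row index \<open>p\<close>) by
  \<open>1 / (1 - x\<^bsup>m + 1\<^esup> y\<^bsup>m + n\<^esup>)\<close>: row \<open>p\<close> of the product is row \<open>p\<close> of the factor plus row
  \<open>p - (m + 1)\<close> of the product, shifted by \<open>m + n\<close>. The rows of the product are accumulated in
  reverse order on top of \<open>m + 1\<close> zero rows. The entries are integers because these have a
  binary representation in the code generator's setup, unlike natural numbers.
\<close>
definition multiply_table :: "nat \<Rightarrow> atomic_stump \<Rightarrow> int list list \<Rightarrow> int list list" where
  "multiply_table W s T = (case s of Stump m n \<Rightarrow>
     drop (Suc m) (rev (foldl (\<lambda>acc row. map2 (+) row (replicate (m + n) 0 @ acc ! m) # acc)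
       (replicate (Suc m) (replicate W 0)) T)))"

lemma multiply_count_table:
  assumes "finite X" "s \<notin> X"
  shows "multiply_table W s (count_table P W X) = count_table P W (insert s X)"
proof -
  obtain m n where s: "s = Stump m n" by (cases s)
  define c where "c p w = int (card (stump_multisets X p w))" for p w
  define c' where "c' p w = int (card (stump_multisets (insert s X) p w))" for p w
  \<comment> \<open>These are the rows of the product below \<open>m + 1\<close> zero rows, so row
    \<open>j\<close> of the product is \<open>g (j + Suc m)\<close>.\<close>
  define g where "g j = map (\<lambda>w. if j < Suc m then 0 else c' (j - Suc m) w) [0..<W]" for j
  have step: "g (j + Suc m) = map2 (+) (map (c j) [0..<W]) (replicate (m + n) 0 @ g j)" for j
  proof (rule nth_equalityI)
    fix w assume "w < length (g (j + Suc m))"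
    then have w: "w < W" by (simp add: g_def)
    have "c' j w = c j w + (if m < j \<and> m + n \<le> w then c' (j - Suc m) (w - (m + n)) else 0)"
      using card_stump_multisets_insert[OF assms(1), of m n j w] assms(2)
      by (auto simp: c_def c'_def s)
    with w show "g (j + Suc m) ! w = map2 (+) (map (c j) [0..<W]) (replicate (m + n) 0 @ g j) ! w"
      by (auto simp: g_def nth_append)
  qed (simp add: g_def)
  have "foldl (\<lambda>acc row. map2 (+) row (replicate (m + n) 0 @ acc ! m) # acc)
      (replicate (Suc m) (replicate W 0)) (map (\<lambda>p. map (c p) [0..<W]) [0..<k]) =
      rev (map g [0..<k + Suc m])" for k
  proof (induction k)
    case 0
    have "map g [0..<Suc m] = replicate (Suc m) (replicate W 0)"
      by (rule nth_equalityI) (auto simp: g_def map_replicate_const simp del: upt_Suc replicate_Suc)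
    then show ?case by (simp del: upt_Suc replicate_Suc)
  next
    case (Suc k)
    \<comment> \<open>In the reversed accumulator, index \<open>m\<close> reaches back
      \<open>m + 1\<close> rows.\<close>
    have "rev (map g [0..<k + Suc m]) ! m = g k"
      by (simp add: rev_nth del: upt_Suc)
    moreover have "[0..<Suc k + Suc m] = [0..<k + Suc m] @ [k + Suc m]" "[0..<Suc k] = [0..<k] @ [k]"
      by simp_all
    ultimately show ?case
      using Suc step[of k] by (simp del: upt_Suc replicate_Suc add_Suc_right add_Suc)
  qed
  from this[of P] have "multiply_table W s (count_table P W X) = drop (Suc m) (map g [0..<P + Suc m])"
    by (simp add: multiply_table_def count_table_def s c_def[abs_def] del: upt_Suc replicate_Suc add_Suc_right)
  also have "\<dots> = map (\<lambda>p. g (p + Suc m)) [0..<P]"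
    by (rule nth_equalityI) (auto simp: add.commute simp del: upt_Suc)
  also have "\<dots> = count_table P W (insert s X)"
    by (simp add: count_table_def g_def c'_def)
  finally show ?thesis .
qed

lemma count_table_empty:
  "count_table (Suc P) (Suc W) {} = (1 # replicate W 0) # replicate P (replicate (Suc W) 0)"
proof -
  have "stump_multisets {} p w = (if p = 0 \<and> w = 0 then {{#}} else {})" for p w
    by (auto simp: stump_multisets_def)
  then show ?thesis
    by (auto simp: count_table_def map_replicate_const intro!: nth_equalityI
        simp: nth_Cons nth_append simp del: upt_Suc split: nat.splits)
qed

lemma foldr_multiply_table:
  assumes "distinct xs"
  shows "foldr (multiply_table W) xs (count_table P W {}) = count_table P W (set xs)"
  using assms by (induction xs) (auto simp: multiply_count_table)

section \<open>Restriction to finitely many stumps and evaluation\<close>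

definition stumps_below :: "nat \<Rightarrow> atomic_stump list" where
  "stumps_below W = tl (concat (map (\<lambda>m. map (Stump m) [0..<W - m]) [0..<W]))"

lemma stumps_below:
  assumes "W > 0"
  shows "distinct (stumps_below W)"
    and "set (stumps_below W) = {s. s \<noteq> Stump 0 0 \<and> leaf_children s + valencies s < W}"
proof -
  let ?xs = "concat (map (\<lambda>m. map (Stump m) [0..<W - m]) [0..<W])"
  have "distinct ?xs"
    by (rule distinct_concat) (auto simp: distinct_map inj_on_def dest: map_eq_imp_length_eq)
  moreover have "?xs = Stump 0 0 # stumps_below W"
    using assms by (simp add: stumps_below_def upt_conv_Cons)
  moreover have "set ?xs = {s. leaf_children s + valencies s < W}"
  proof (rule set_eqI)
    fix s show "s \<in> set ?xs \<longleftrightarrow> s \<in> {s. leaf_children s + valencies s < W}"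
      by (cases s) (auto simp: image_iff)
  qed
  ultimately show "distinct (stumps_below W)"
    "set (stumps_below W) = {s. s \<noteq> Stump 0 0 \<and> leaf_children s + valencies s < W}"
    by auto
qed

text \<open>A stump with \<open>m + n\<close> above \<open>w\<close> would already exceed the child
  weight.\<close>

lemma stump_multisets_stumps_below:
  assumes "w < W"
  shows "stump_multisets (set (stumps_below W)) p w = stump_multisets (- {Stump 0 0}) p w"
proof -
  have "leaf_children s + valencies s \<le> child_weight M" if "s \<in># M" for s M
    using that by (induction M) auto
  then show ?thesis
    using assms by (fastforce simp: stump_multisets_def stumps_below)
qed

text \<open>The count for \<open>p\<close> vertices stands in row \<open>p\<close>, column
  \<open>p - 1\<close>; dropping rows 0 and 1 aligns row 2 with column 1.\<close>

lemma num_isomeric_table_diagonal: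
  assumes "W > 0"
  shows "map (\<lambda>p. int (num_isomeric p)) [2..<Suc W] =
    map2 nth (drop 2 (foldr (multiply_table W) (stumps_below W) (count_table (Suc W) W {}))) [1..<W]"
  unfolding foldr_multiply_table[OF stumps_below(1)[OF assms]] using assms
  by (auto intro!: nth_equalityI simp: count_table_def
      num_isomeric_eq_card_image stump_factors_image stump_multisets_stumps_below simp del: upt_Suc)

text \<open>The initial table is written out explicitly, since \<open>count_table\<close> is defined
  by cardinalities of sets.\<close>

lemma table_diagonal_20:
  "map2 nth (drop 2 (foldr (multiply_table 20) (stumps_below 20)
       ((1 # replicate 19 0) # replicate 20 (replicate 20 0)))) [1..<20] =
     [1, 2, 4, 8, 15, 28, 51, 91, 160, 278, 475, 803, 1342, 2218, 3629, 5885, 9455, 15068, 23824]"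
  by code_simp

lemma num_isomeric_values:
  "map num_isomeric [1..<21] =
     [1, 1, 2, 4, 8, 15, 28, 51, 91, 160, 278, 475, 803, 1342, 2218, 3629, 5885, 9455, 15068, 23824]"
proof -
  have "count_table 21 20 {} = (1 # replicate 19 0) # replicate 20 (replicate 20 0)"
    using count_table_empty[of 20 19] by (simp del: replicate_Suc)
  then have "map (\<lambda>p. int (num_isomeric p)) [2..<21] =
     [1, 2, 4, 8, 15, 28, 51, 91, 160, 278, 475, 803, 1342, 2218, 3629, 5885, 9455, 15068, 23824]"
    using num_isomeric_table_diagonal[of 20] table_diagonal_20 by simp
  then have "map nat (map (\<lambda>p. int (num_isomeric p)) [2..<21]) = map nat
     [1, 2, 4, 8, 15, 28, 51, 91, 160, 278, 475, 803, 1342, 2218, 3629, 5885, 9455, 15068, 23824]"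
    by (rule arg_cong)
  then have "map num_isomeric [2..<21] =
     [1, 2, 4, 8, 15, 28, 51, 91, 160, 278, 475, 803, 1342, 2218, 3629, 5885, 9455, 15068, 23824]"
    by (simp add: comp_def del: upt_Suc)
  moreover have "[1..<21] = 1 # [2..<21]"
    by (simp add: upt_conv_Cons del: upt_Suc)
  ultimately show ?thesis
    by (simp add: num_isomeric_1[simplified])
qed

lemma num_conditions_1: "num_conditions (Suc 0) = num_isomeric (Suc 0)"
  by (simp add: num_conditions_def)

lemma num_conditions_numeral:
  "num_conditions (numeral k) = num_conditions (pred_numeral k) + num_isomeric (numeral k)"
  by (simp add: num_conditions_def numeral_eq_Suc)

theorem mainTheorem2:
  "map num_isomeric [1..<21] =
     [1, 1, 2, 4, 8, 15, 28, 51, 91, 160, 278, 475, 803, 1342, 2218, 3629, 5885, 9455, 15068, 23824]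
   \<and> map num_conditions [1..<21] =
     [1, 2, 4, 8, 16, 31, 59, 110, 201, 361, 639, 1114, 1917, 3259, 5477, 9106, 14991, 24446, 39514, 63338]"
proof
  show "map num_isomeric [1..<21] =
     [1, 1, 2, 4, 8, 15, 28, 51, 91, 160, 278, 475, 803, 1342, 2218, 3629, 5885, 9455, 15068, 23824]"
    by (rule num_isomeric_values)
  have "[1..<21] = [1, 2, 3, 4, 5, 6, 7, 8, 9, 10, 11, 12, 13, 14, 15, 16, 17, 18, 19, 20]"
    by code_simp
  then show "map num_conditions [1..<21] =
     [1, 2, 4, 8, 16, 31, 59, 110, 201, 361, 639, 1114, 1917, 3259, 5477, 9106, 14991, 24446, 39514, 63338]"
    using num_isomeric_values by (simp add: num_conditions_numeral num_conditions_1 del: upt_Suc)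
qed

end
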